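(* The kissing numbers in dimensions $9$, $10$, $16$, $17$, $25$ and $26$ satisfy $$k(9)\le 379,\quad k(10)\le 594,\quad k(16)\le 8312,\quad k(17)\le 12210,\quad k(25)\le 278083,\quad k(26)\le 396447.$$
   Context: The kissing number $k(n)$ is the maximum number of non-overlapping unit balls in $\mathbb{R}^n$ that touch a central unit ball. Equivalently, $k(n)$ is the maximum $N$ for which there are $N$ unit vectors $\mathbf{x}_1,\ldots,\mathbf{x}_N\in\mathbb{R}^n$ with pairwise angular distance at least $\pi/3$, i.e. $\langle\mathbf{x}_i,\mathbf{x}_j\rangle\le\frac12$ for $i\neq j$. For comparison, the lower bounds listed for $n=9,10,16,17,25,26$ are $306$, $500$, $4320$, $5346$, $196656$, $196848$, and the upper bounds listed from the classical Delsarte linear programming method are $380$, $595$, $8313$, $12218$, $278363$, $396974$ (with some extra inequalities added to the Delsarte method, $379$ for $n=9$ and $12215$ for $n=17$). Thus the value $379$ for $n=9$ was already known. *)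

theory Defs
  imports "HOL-Analysis.Analysis"
begin

text \<open>
  A family of unit balls is given by the set \<open>C\<close> of their centres; the central ball is
  centred at the origin. Balls are closed, so they touch when they meet, and they do not
  overlap when their interiors (the open balls) are disjoint.
\<close>

definition kissing_arrangement :: "'a::euclidean_space set \<Rightarrow> bool" where
  "kissing_arrangement C \<longleftrightarrow>
     (\<forall>c\<in>C. cball c 1 \<inter> cball 0 1 \<noteq> {} \<and> ball c 1 \<inter> ball 0 1 = {}) \<and>
     pairwise (\<lambda>c d. ball c 1 \<inter> ball d 1 = {}) C"

text \<open>
  The dimension is carried by the type, so \<open>k(n)\<close> is \<open>kissing_number TYPE(real ^ 'n)\<close> with
  \<open>CARD('n) = n\<close>. The maximum is over a finite nonempty set of numbers, see
  \<open>finite_kissing_cards\<close> and \<open>kissing_number_is_max\<close> below.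
\<close>

definition kissing_number :: "'a::euclidean_space itself \<Rightarrow> nat" where
  "kissing_number _ = Max {card C | C :: 'a set. finite C \<and> kissing_arrangement C}"

lemma unit_balls_disjoint_iff:
  fixes c d :: "'a::euclidean_space"
  shows "ball c 1 \<inter> ball d 1 = {} \<longleftrightarrow> 2 \<le> dist c d"
proof
  assume "ball c 1 \<inter> ball d 1 = {}"
  then have "midpoint c d \<notin> ball c 1 \<inter> ball d 1" by simp
  then show "2 \<le> dist c d"
    by (auto simp: dist_midpoint)
next
  assume "2 \<le> dist c d"
  then show "ball c 1 \<inter> ball d 1 = {}"
    by (intro disjoint_ballI) simp
qed

lemma unit_cballs_meet_iff:
  fixes c d :: "'a::euclidean_space"
  shows "cball c 1 \<inter> cball d 1 \<noteq> {} \<longleftrightarrow> dist c d \<le> 2"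
proof
  assume "cball c 1 \<inter> cball d 1 \<noteq> {}"
  then obtain x where "dist c x \<le> 1" "dist d x \<le> 1" by auto
  then show "dist c d \<le> 2"
    using dist_triangle2[of c d x] by linarith
next
  assume "dist c d \<le> 2"
  then have "midpoint c d \<in> cball c 1 \<inter> cball d 1"
    by (auto simp: dist_midpoint)
  then show "cball c 1 \<inter> cball d 1 \<noteq> {}" by blast
qed

lemma kissing_arrangement_iff:
  "kissing_arrangement C \<longleftrightarrow>
     (\<forall>c\<in>C. norm c = 2) \<and> pairwise (\<lambda>c d. 2 \<le> dist c d) C"
  unfolding kissing_arrangement_def unit_balls_disjoint_iff unit_cballs_meet_iff
  by (auto intro: order_antisym)

lemma finite_kissing_cards:
  "finite {card C | C :: 'a::euclidean_space set. finite C \<and> kissing_arrangement C}"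
proof -
  have "compact (cball (0::'a) 2)" by simp
  then obtain K :: "'a set" where K: "finite K" "cball 0 2 \<subseteq> (\<Union>k\<in>K. ball k 1)"
    using compactE_image[of "cball (0::'a) 2" "cball 0 2" "\<lambda>k. ball k 1"]
    by (metis UN_I centre_in_ball open_ball subsetI zero_less_one)
  have "card C \<le> card K" if C: "finite C" "kissing_arrangement C" for C :: "'a set"
  proof -
    have n: "norm c = 2" if "c \<in> C" for c
      using C that by (auto simp: kissing_arrangement_iff)
    have d: "2 \<le> dist c c'" if "c \<in> C" "c' \<in> C" "c \<noteq> c'" for c c'
      using C that by (auto simp: kissing_arrangement_iff pairwise_def)
    have "\<forall>c\<in>C. \<exists>k\<in>K. c \<in> ball k 1"
      using K(2) n by (force simp: subset_iff)
    then obtain f where f: "\<And>c. c \<in> C \<Longrightarrow> f c \<in> K \<and> c \<in> ball (f c) 1" by metis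
    have "inj_on f C"
    proof (rule inj_onI, rule ccontr)
      fix c c' assume *: "c \<in> C" "c' \<in> C" "f c = f c'" "c \<noteq> c'"
      have "dist (f c) c < 1" "dist (f c) c' < 1" using f[of c] f[of c'] * by auto
      then have "dist c c' < 2" using dist_triangle3[of c c' "f c"] by linarith
      with d * show False by force
    qed
    then show ?thesis using f K(1) by (intro card_inj_on_le) auto
  qed
  then have "{card C | C :: 'a set. finite C \<and> kissing_arrangement C} \<subseteq> {..card K}" by auto
  then show ?thesis by (rule finite_subset) simp
qed

lemma kissing_number_is_max:
  "\<exists>C :: 'a::euclidean_space set.
     finite C \<and> kissing_arrangement C \<and> card C = kissing_number TYPE('a)"
  "\<And>C :: 'a set. finite C \<Longrightarrow> kissing_arrangement C \<Longrightarrow> card C \<le> kissing_number TYPE('a)"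
proof -
  let ?S = "{card C | C :: 'a set. finite C \<and> kissing_arrangement C}"
  have "kissing_arrangement ({} :: 'a set)" by (simp add: kissing_arrangement_iff)
  then have "?S \<noteq> {}" by blast
  then have "Max ?S \<in> ?S" using finite_kissing_cards Max_in by blast
  then show "\<exists>C :: 'a set. finite C \<and> kissing_arrangement C \<and> card C = kissing_number TYPE('a)"
    unfolding kissing_number_def by (smt (verit) mem_Collect_eq)
  show "card C \<le> kissing_number TYPE('a)" if "finite C" "kissing_arrangement C" for C :: "'a set"
    unfolding kissing_number_def using that finite_kissing_cards by (intro Max_ge) auto
qed

lemma kissing_arrangement_unit_vectors_iff:
  fixes X :: "'a::euclidean_space set"
  shows "kissing_arrangement ((\<lambda>x. 2 *\<^sub>R x) ` X) \<longleftrightarrow>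
     (\<forall>x\<in>X. norm x = 1) \<and> pairwise (\<lambda>x y. x \<bullet> y \<le> 1 / 2) X"
proof -
  have "2 \<le> dist (2 *\<^sub>R x) (2 *\<^sub>R y) \<longleftrightarrow> x \<bullet> y \<le> 1 / 2"
    if "norm x = 1" "norm y = 1" for x y :: 'a
  proof -
    have eq: "(norm (x - y))\<^sup>2 = 2 - 2 * (x \<bullet> y)"
      using that by (simp add: dot_norm_neg field_simps)
    have "2 \<le> dist (2 *\<^sub>R x) (2 *\<^sub>R y) \<longleftrightarrow> 1 \<le> norm (x - y)"
      by (simp add: dist_norm flip: scaleR_diff_right)
    also have "\<dots> \<longleftrightarrow> 1 \<le> (norm (x - y))\<^sup>2"
      using abs_le_square_iff[of 1 "norm (x - y)"] by simp
    finally show ?thesis using eq by auto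
  qed
  then show ?thesis
    unfolding kissing_arrangement_iff pairwise_image by (auto simp: pairwise_def)
qed

end

theory Submission
  imports Defs
begin

text \<open>
  Pfender's extension of the Delsarte linear programming bound. Let \<open>f = (\<Sum>k. c\<^sub>k G\<^sub>k)\<close> with
  \<open>c\<^sub>k \<ge> 0\<close>, where \<open>G\<^sub>k\<close> are the Gegenbauer polynomials of the dimension. They are positive
  definite, so \<open>c\<^sub>0 N\<^sup>2\<close> is at most the sum of \<open>f (x \<bullet> y)\<close> over all ordered pairs of the \<open>N\<close> unit
  vectors. Unlike in the classical method, \<open>f\<close> may be positive near \<open>-1\<close>: it is enough that
  \<open>f \<le> 0\<close> on \<open>[-\<rho>, 1/2]\<close> and \<open>f t \<le> B (2 t\<^sup>2 - 1)\<close> on \<open>[-1, -\<rho>]\<close> with \<open>\<rho> \<ge> 1/\<surd>2\<close>,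
  because the numbers \<open>2 (x \<bullet> y)\<^sup>2 - 1\<close> over the vectors \<open>y\<close> of the far cap of \<open>x\<close> add up to at
  most \<open>1\<close>. Each row of the pair sum is then at most \<open>f 1 + B\<close>, and \<open>N \<le> (f 1 + B) / c\<^sub>0\<close>.

  For positive definiteness, \<open>G\<^sub>k (x \<bullet> y)\<close> is realised, up to a positive factor, as the Fischer
  inner product of two harmonic polynomials, the harmonic projections of \<open>(x \<bullet> z)\<^sup>k\<close> and
  \<open>(y \<bullet> z)\<^sup>k\<close>.
\<close>

subsection \<open>Polynomials in several variables\<close>

text \<open>
  A polynomial in the variables \<open>z\<^sub>i\<close> is given by its coefficients, indexed by exponents \<open>\<alpha>\<close>.
  The functions are not required to have finite support: \<open>exp_coeffs x\<close> is the power series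
  of \<open>exp (x \<bullet> z)\<close>, and \<open>fischer d\<close> selects the homogeneous components of degree \<open>d\<close>, so that one
  eigenvector of \<open>laplace\<close> serves all degrees.
\<close>

definition multi_indices :: "nat \<Rightarrow> ('n::finite \<Rightarrow> nat) set" where
  "multi_indices d = {\<alpha>. (\<Sum>i\<in>UNIV. \<alpha> i) = d}"

definition fischer :: "nat \<Rightarrow> (('n::finite \<Rightarrow> nat) \<Rightarrow> real) \<Rightarrow> (('n \<Rightarrow> nat) \<Rightarrow> real) \<Rightarrow> real" where
  "fischer d f g = (\<Sum>\<alpha>\<in>multi_indices d. (\<Prod>i\<in>UNIV. fact (\<alpha> i)) * f \<alpha> * g \<alpha>)"

text \<open>Multiplication by \<open>\<Sum>i. z\<^sub>i\<^sup>2\<close>. The guard keeps truncated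
  subtraction from reading off a wrong coefficient.\<close>

definition norm2_mult :: "(('n::finite \<Rightarrow> nat) \<Rightarrow> real) \<Rightarrow> ('n \<Rightarrow> nat) \<Rightarrow> real" where
  "norm2_mult f \<alpha> = (\<Sum>i\<in>UNIV. if 2 \<le> \<alpha> i then f (\<alpha>(i := \<alpha> i - 2)) else 0)"

definition laplace :: "(('n::finite \<Rightarrow> nat) \<Rightarrow> real) \<Rightarrow> ('n \<Rightarrow> nat) \<Rightarrow> real" where
  "laplace f \<alpha> = (\<Sum>i\<in>UNIV. real ((\<alpha> i + 2) * (\<alpha> i + 1)) * f (\<alpha>(i := \<alpha> i + 2)))"

definition exp_coeffs :: "real ^ 'n::finite \<Rightarrow> ('n \<Rightarrow> nat) \<Rightarrow> real" where
  "exp_coeffs x \<alpha> = (\<Prod>i\<in>UNIV. x $ i ^ \<alpha> i / fact (\<alpha> i))"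

lemma finite_multi_indices: "finite (multi_indices d :: ('n::finite \<Rightarrow> nat) set)"
proof -
  have "multi_indices d \<subseteq> Pi\<^sub>E (UNIV :: 'n set) (\<lambda>_. {..d})"
    unfolding multi_indices_def
    by (auto simp: PiE_def extensional_def intro!: member_le_sum)
  then show ?thesis by (rule finite_subset) (intro finite_PiE; simp)
qed

section \<open>Exponents with one entry changed\<close>

lemma sum_fun_upd:
  fixes \<alpha> :: "'n::finite \<Rightarrow> nat"
  shows "(\<Sum>j\<in>UNIV. (\<alpha>(i := m)) j) + \<alpha> i = (\<Sum>j\<in>UNIV. \<alpha> j) + m"
proof -
  have "(\<Sum>j\<in>UNIV. (\<alpha>(i := m)) j) = m + (\<Sum>j\<in>UNIV - {i}. \<alpha> j)"
    by (subst sum.remove[of _ i]) auto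
  moreover have "(\<Sum>j\<in>UNIV. \<alpha> j) = \<alpha> i + (\<Sum>j\<in>UNIV - {i}. \<alpha> j)"
    by (subst sum.remove[of _ i]) auto
  ultimately show ?thesis by simp
qed

lemma prod_fun_upd:
  fixes \<alpha> :: "'n::finite \<Rightarrow> nat" and h :: "'n \<Rightarrow> nat \<Rightarrow> 'b::comm_monoid_mult"
  shows "(\<Prod>j\<in>UNIV. h j ((\<alpha>(i := m)) j)) = h i m * (\<Prod>j\<in>UNIV - {i}. h j (\<alpha> j))"
  by (subst prod.remove[of _ i]) auto

lemma prod_split_at:
  fixes \<alpha> :: "'n::finite \<Rightarrow> nat" and h :: "'n \<Rightarrow> nat \<Rightarrow> 'b::comm_monoid_mult"
  shows "(\<Prod>j\<in>UNIV. h j (\<alpha> j)) = h i (\<alpha> i) * (\<Prod>j\<in>UNIV - {i}. h j (\<alpha> j))"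
  by (subst prod.remove[of _ i]) auto

text \<open>Used with \<open>m = 2\<close> for second derivatives and with \<open>m = 1\<close> for
  Euler's identity.\<close>

lemma sum_multi_indices_shift:
  fixes g :: "('n::finite \<Rightarrow> nat) \<Rightarrow> real"
  shows "(\<Sum>\<alpha>\<in>multi_indices (d + m). if m \<le> \<alpha> i then g \<alpha> else 0) =
    (\<Sum>\<beta>\<in>multi_indices d. g (\<beta>(i := \<beta> i + m)))"
proof -
  have "(\<Sum>\<alpha>\<in>multi_indices (d + m). if m \<le> \<alpha> i then g \<alpha> else 0) =
      (\<Sum>\<alpha>\<in>{\<alpha>\<in>multi_indices (d + m). m \<le> \<alpha> i}. g \<alpha>)"
    by (simp add: sum.If_cases finite_multi_indices Int_def conj_commute)
  also have "\<dots> = (\<Sum>\<beta>\<in>multi_indices d. g (\<beta>(i := \<beta> i + m)))"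
  proof (rule sum.reindex_bij_witness[of _ "\<lambda>\<beta>. \<beta>(i := \<beta> i + m)" "\<lambda>\<alpha>. \<alpha>(i := \<alpha> i - m)"])
    fix \<beta> :: "'n \<Rightarrow> nat" assume "\<beta> \<in> multi_indices d"
    then show "\<beta>(i := \<beta> i + m) \<in> {\<alpha> \<in> multi_indices (d + m). m \<le> \<alpha> i}"
      using sum_fun_upd[of \<beta> i "\<beta> i + m"] by (simp add: multi_indices_def)
  next
    fix \<alpha> :: "'n \<Rightarrow> nat" assume "\<alpha> \<in> {\<alpha> \<in> multi_indices (d + m). m \<le> \<alpha> i}"
    then show "\<alpha>(i := \<alpha> i - m) \<in> multi_indices d"
      using sum_fun_upd[of \<alpha> i "\<alpha> i - m"] by (simp add: multi_indices_def)
  qed auto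
  finally show ?thesis .
qed

lemma fact_add_2: "fact (m + 2) = real ((m + 2) * (m + 1)) * fact m"
  by (simp add: fact_reduce algebra_simps)

section \<open>The Laplacian and multiplication by the squared norm\<close>

text \<open>The factorial weights make \<open>z\<^sub>i\<^sup>2\<close> adjoint to the second
  derivative in \<open>z\<^sub>i\<close>: raising \<open>\<alpha> i\<close> by 2 multiplies the
  weight by exactly the factor that differentiation produces.\<close>

lemma fischer_norm2_mult: "fischer (d + 2) (norm2_mult f) g = fischer d f (laplace g)"
proof -
  let ?w = "\<lambda>\<alpha> :: 'a \<Rightarrow> nat. \<Prod>j\<in>UNIV. fact (\<alpha> j) :: real"
  have w: "?w (\<alpha>(i := \<alpha> i + 2)) = real ((\<alpha> i + 2) * (\<alpha> i + 1)) * ?w \<alpha>" for \<alpha> i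
    using prod_fun_upd[of "\<lambda>_. fact :: nat \<Rightarrow> real" \<alpha> i "\<alpha> i + 2"]
      prod_split_at[of "\<lambda>_. fact :: nat \<Rightarrow> real" \<alpha> i] fact_add_2[of "\<alpha> i"]
    by (metis (no_types, lifting) mult.assoc)
  have "fischer (d + 2) (norm2_mult f) g =
      (\<Sum>i\<in>UNIV. \<Sum>\<alpha>\<in>multi_indices (d + 2).
        if 2 \<le> \<alpha> i then ?w \<alpha> * f (\<alpha>(i := \<alpha> i - 2)) * g \<alpha> else 0)"
    unfolding fischer_def norm2_mult_def sum_distrib_left sum_distrib_right
    by (subst sum.swap) (intro sum.cong refl; auto)
  also have "\<dots> = (\<Sum>i\<in>UNIV. \<Sum>\<beta>\<in>multi_indices d.
      ?w (\<beta>(i := \<beta> i + 2)) * f \<beta> * g (\<beta>(i := \<beta> i + 2)))"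
    by (rule sum.cong[OF refl], subst sum_multi_indices_shift) simp
  also have "\<dots> = fischer d f (laplace g)"
    unfolding fischer_def laplace_def sum_distrib_left w
    by (subst sum.swap) (intro sum.cong refl; simp add: algebra_simps)
  finally show ?thesis .
qed

text \<open>The commutator of the two operators is \<open>4 E + 2 n\<close>, where \<open>E\<close>
  is the Euler operator, which multiplies by the degree. The mixed terms \<open>u i l\<close> with
  \<open>i \<noteq> l\<close> cancel.\<close>

lemma laplace_norm2_mult:
  fixes f :: "('n::finite \<Rightarrow> nat) \<Rightarrow> real"
  shows "laplace (norm2_mult f) \<alpha> =
    norm2_mult (laplace f) \<alpha> + (4 * real (\<Sum>i\<in>UNIV. \<alpha> i) + 2 * real CARD('n)) * f \<alpha>"
proof -
  define u where "u i l = (if 2 \<le> \<alpha> l then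
      real ((\<alpha> i + 2) * (\<alpha> i + 1)) * f (\<alpha>(i := \<alpha> i + 2, l := \<alpha> l - 2)) else 0)" for i l
  have A: "laplace (norm2_mult f) \<alpha> =
      (\<Sum>i\<in>UNIV. real ((\<alpha> i + 2) * (\<alpha> i + 1)) * f \<alpha> + (\<Sum>l\<in>UNIV - {i}. u i l))"
    unfolding laplace_def norm2_mult_def
  proof (intro sum.cong refl)
    fix i :: 'n
    show "real ((\<alpha> i + 2) * (\<alpha> i + 1)) *
        (\<Sum>l\<in>UNIV. if 2 \<le> (\<alpha>(i := \<alpha> i + 2)) l
           then f ((\<alpha>(i := \<alpha> i + 2))(l := (\<alpha>(i := \<alpha> i + 2)) l - 2)) else 0) =
        real ((\<alpha> i + 2) * (\<alpha> i + 1)) * f \<alpha> + (\<Sum>l\<in>UNIV - {i}. u i l)"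
      unfolding u_def sum_distrib_left
      by (subst sum.remove[of _ i]) (simp_all add: if_distrib cong: if_cong)
  qed
  have B: "norm2_mult (laplace f) \<alpha> =
      (\<Sum>l\<in>UNIV. (if 2 \<le> \<alpha> l then real (\<alpha> l * (\<alpha> l - 1)) * f \<alpha> else 0) + (\<Sum>i\<in>UNIV - {l}. u i l))"
    unfolding laplace_def norm2_mult_def
  proof (intro sum.cong refl)
    fix l :: 'n
    show "(if 2 \<le> \<alpha> l then \<Sum>i\<in>UNIV. real (((\<alpha>(l := \<alpha> l - 2)) i + 2) * ((\<alpha>(l := \<alpha> l - 2)) i + 1)) *
          f ((\<alpha>(l := \<alpha> l - 2))(i := (\<alpha>(l := \<alpha> l - 2)) i + 2)) else 0) =
        (if 2 \<le> \<alpha> l then real (\<alpha> l * (\<alpha> l - 1)) * f \<alpha> else 0) + (\<Sum>i\<in>UNIV - {l}. u i l)"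
    proof (cases "2 \<le> \<alpha> l")
      case True
      then have "\<alpha> l - 2 + 1 = \<alpha> l - 1" "\<alpha> l - 2 + 2 = \<alpha> l" by simp_all
      with True show ?thesis
        unfolding u_def
        by (subst sum.remove[of _ l]) (auto intro!: sum.cong simp: fun_upd_twist)
    qed (simp add: u_def)
  qed
  have C: "(\<Sum>l\<in>UNIV. \<Sum>i\<in>UNIV - {l}. u i l) = (\<Sum>i\<in>UNIV. \<Sum>l\<in>UNIV - {i}. u i l)"
    by (simp add: sum_diff1 sum_subtractf) (rule sum.swap)
  \<comment> \<open>This is \<open>(a + 2) (a + 1) - a (a - 1) = 4 a + 2\<close>; for
    \<open>a < 2\<close> the product \<open>a (a - 1)\<close> is 0, in accordance with the
    guard.\<close>
  have D: "real ((\<alpha> i + 2) * (\<alpha> i + 1)) * f \<alpha> =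
      (if 2 \<le> \<alpha> i then real (\<alpha> i * (\<alpha> i - 1)) * f \<alpha> else 0) + (4 * real (\<alpha> i) + 2) * f \<alpha>" for i
  proof (cases "2 \<le> \<alpha> i")
    case True
    then obtain m where "\<alpha> i = m + 2" by (metis le_add_diff_inverse2)
    then show ?thesis by (simp add: algebra_simps)
  next
    case False
    then have "\<alpha> i = 0 \<or> \<alpha> i = 1" by linarith
    then show ?thesis by auto
  qed
  have E: "(\<Sum>i\<in>UNIV. (4 * real (\<alpha> i) + 2) * f \<alpha>) =
      (4 * real (\<Sum>i\<in>UNIV. \<alpha> i) + 2 * real CARD('n)) * f \<alpha>"
    by (simp add: sum.distrib sum_distrib_left sum_distrib_right distrib_right)
  show ?thesis
    unfolding A B D sum.distrib C E by simp
qed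

lemma norm2_mult_linear:
  "norm2_mult (\<lambda>\<beta>. a * f \<beta> + g \<beta>) \<alpha> = a * norm2_mult f \<alpha> + norm2_mult g \<alpha>"
  unfolding norm2_mult_def sum_distrib_left sum.distrib[symmetric]
  by (intro sum.cong) auto

lemma laplace_sum:
  "laplace (\<lambda>\<beta>. \<Sum>j\<in>J. c j * f j \<beta>) \<alpha> = (\<Sum>j\<in>J. c j * laplace (f j) \<alpha>)"
  unfolding laplace_def sum_distrib_left
  by (subst sum.swap) (intro sum.cong refl; simp)

text \<open>Only coefficients two degrees lower enter. This lets a factor that depends on the degree
  be treated as a constant.\<close>

lemma norm2_mult_cong:
  assumes "\<And>\<beta>. (\<Sum>i\<in>UNIV. \<beta> i) + 2 = (\<Sum>i\<in>UNIV. \<alpha> i) \<Longrightarrow> f \<beta> = g \<beta>"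
  shows "norm2_mult f \<alpha> = norm2_mult g \<alpha>"
  unfolding norm2_mult_def
proof (intro sum.cong refl if_cong)
  fix i assume "2 \<le> \<alpha> i"
  then show "f (\<alpha>(i := \<alpha> i - 2)) = g (\<alpha>(i := \<alpha> i - 2))"
    using sum_fun_upd[of \<alpha> i "\<alpha> i - 2"] by (intro assms) simp
qed

lemma norm2_mult_power_eq_0:
  "(\<Sum>i\<in>UNIV. \<alpha> i) < 2 * j \<Longrightarrow> (norm2_mult ^^ j) f \<alpha> = 0"
proof (induction j arbitrary: \<alpha>)
  case (Suc j)
  have "norm2_mult ((norm2_mult ^^ j) f) \<alpha> = norm2_mult (\<lambda>_. 0) \<alpha>"
    using Suc by (intro norm2_mult_cong) simp
  also have "\<dots> = 0" by (simp add: norm2_mult_def)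
  finally show ?case by simp
qed simp

lemma laplace_exp_coeffs: "laplace (exp_coeffs x) \<alpha> = (norm x)\<^sup>2 * exp_coeffs x \<alpha>"
proof -
  have "real ((\<alpha> i + 2) * (\<alpha> i + 1)) * exp_coeffs x (\<alpha>(i := \<alpha> i + 2)) = (x $ i)\<^sup>2 * exp_coeffs x \<alpha>" for i
  proof -
    have "real ((m + 2) * (m + 1)) * (z ^ (m + 2) / fact (m + 2)) = z\<^sup>2 * (z ^ m / fact m)" for m and z :: real
      unfolding fact_add_2 by (simp add: power_add power2_eq_square del: of_nat_mult of_nat_add)
    then show ?thesis
      unfolding exp_coeffs_def
      using prod_fun_upd[of "\<lambda>j m. x $ j ^ m / fact m" \<alpha> i "\<alpha> i + 2"]
        prod_split_at[of "\<lambda>j m. x $ j ^ m / fact m" \<alpha> i]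
      by (metis (no_types, lifting) mult.assoc)
  qed
  then show ?thesis
    unfolding laplace_def by (simp add: sum_distrib_right norm_vec_def L2_set_def sum_nonneg)
qed

text \<open>Summing the commutator terms \<open>4 (e - 2 s) + 2 n\<close> over
  \<open>s \<le> j\<close>, with \<open>e\<close> the degree, gives the factor. In the induction the
  hypothesis is used in degree \<open>e - 2\<close>, hence the \<open>- 4\<close> below.\<close>

lemma laplace_norm2_mult_power:
  fixes f :: "('n::finite \<Rightarrow> nat) \<Rightarrow> real"
  assumes eig: "\<And>\<alpha>. laplace f \<alpha> = f \<alpha>"
  shows "laplace ((norm2_mult ^^ Suc j) f) \<alpha> = (norm2_mult ^^ Suc j) f \<alpha> +
    2 * real (Suc j) * (2 * real (\<Sum>i\<in>UNIV. \<alpha> i) - 2 * real j + real CARD('n)) * (norm2_mult ^^ j) f \<alpha>"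
proof (induction j arbitrary: \<alpha>)
  case 0
  have "laplace f = f" using eig by blast
  then show ?case using laplace_norm2_mult[of f \<alpha>] by (simp add: algebra_simps)
next
  case (Suc j)
  have "norm2_mult (laplace ((norm2_mult ^^ Suc j) f)) \<alpha> = norm2_mult (\<lambda>\<beta>.
      (2 * real (Suc j) * (2 * real (\<Sum>i\<in>UNIV. \<alpha> i) - 4 - 2 * real j + real CARD('n))) *
      (norm2_mult ^^ j) f \<beta> + (norm2_mult ^^ Suc j) f \<beta>) \<alpha>"
  proof (rule norm2_mult_cong)
    fix \<beta> :: "'n \<Rightarrow> nat"
    assume "(\<Sum>i\<in>UNIV. \<beta> i) + 2 = (\<Sum>i\<in>UNIV. \<alpha> i)"
    then have \<beta>: "real (\<Sum>i\<in>UNIV. \<beta> i) = real (\<Sum>i\<in>UNIV. \<alpha> i) - 2" by linarith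
    show "laplace ((norm2_mult ^^ Suc j) f) \<beta> =
      2 * real (Suc j) * (2 * real (\<Sum>i\<in>UNIV. \<alpha> i) - 4 - 2 * real j + real CARD('n)) *
      (norm2_mult ^^ j) f \<beta> + (norm2_mult ^^ Suc j) f \<beta>"
      unfolding Suc.IH \<beta> by (simp add: algebra_simps del: of_nat_sum)
  qed
  then show ?case
    using laplace_norm2_mult[of "(norm2_mult ^^ Suc j) f" \<alpha>]
    unfolding norm2_mult_linear by (simp add: algebra_simps)
qed

text \<open>The multinomial theorem, by Euler's identity: in degree \<open>Suc d\<close> the factor
  \<open>Suc d\<close> is the sum of the \<open>\<alpha> i\<close>, and each summand splits off one
  \<open>x\<^sub>i y\<^sub>i\<close>.\<close>

lemma fischer_exp_coeffs: "fischer d (exp_coeffs x) (exp_coeffs y) = (x \<bullet> y) ^ d / fact d"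
proof (induction d)
  case 0
  have "multi_indices 0 = {\<lambda>_ :: 'a. 0}" by (auto simp: multi_indices_def)
  then show ?case by (simp add: fischer_def exp_coeffs_def)
next
  case (Suc d)
  define p where "p \<alpha> = (\<Prod>i\<in>UNIV. fact (\<alpha> i)) * exp_coeffs x \<alpha> * exp_coeffs y \<alpha>" for \<alpha>
  have p: "p \<alpha> = (\<Prod>i\<in>UNIV. (x $ i * y $ i) ^ \<alpha> i / fact (\<alpha> i))" for \<alpha>
    unfolding p_def exp_coeffs_def prod.distrib[symmetric]
    by (intro prod.cong refl) (simp add: power_mult_distrib)
  have shift: "real (\<alpha> i + 1) * p (\<alpha>(i := \<alpha> i + 1)) = x $ i * y $ i * p \<alpha>" for \<alpha> i
  proof -
    have "real (m + 1) * (z ^ (m + 1) / fact (m + 1)) = z * (z ^ m / fact m)" for m and z :: real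
      by (simp del: of_nat_Suc)
    then show ?thesis
      unfolding p
      using prod_fun_upd[of "\<lambda>j m. (x $ j * y $ j) ^ m / fact m" \<alpha> i "\<alpha> i + 1"]
        prod_split_at[of "\<lambda>j m. (x $ j * y $ j) ^ m / fact m" \<alpha> i]
      by (metis (no_types, lifting) mult.assoc)
  qed
  have "real (Suc d) * fischer (Suc d) (exp_coeffs x) (exp_coeffs y) =
      (\<Sum>\<alpha>\<in>multi_indices (Suc d). real (\<Sum>i\<in>UNIV. \<alpha> i) * p \<alpha>)"
    unfolding fischer_def sum_distrib_left p_def[symmetric]
    by (intro sum.cong refl) (simp add: multi_indices_def)
  also have "\<dots> = (\<Sum>i\<in>UNIV. \<Sum>\<alpha>\<in>multi_indices (d + 1). if 1 \<le> \<alpha> i then real (\<alpha> i) * p \<alpha> else 0)"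
    unfolding of_nat_sum sum_distrib_right
    by (subst sum.swap) (auto intro!: sum.cong)
  also have "\<dots> = (\<Sum>i\<in>UNIV. x $ i * y $ i * fischer d (exp_coeffs x) (exp_coeffs y))"
    unfolding sum_multi_indices_shift fischer_def sum_distrib_left p_def[symmetric]
    using shift by (intro sum.cong refl) simp
  also have "\<dots> = (x \<bullet> y) * ((x \<bullet> y) ^ d / fact d)"
    unfolding Suc.IH sum_distrib_right[symmetric] by (simp add: inner_vec_def)
  finally show ?case by (simp add: field_simps del: of_nat_Suc)
qed

lemma fischer_sum_left: "fischer d (\<lambda>\<alpha>. \<Sum>j\<in>J. c j * f j \<alpha>) g = (\<Sum>j\<in>J. c j * fischer d (f j) g)"
  unfolding fischer_def sum_distrib_left sum_distrib_right
  by (subst sum.swap) (intro sum.cong refl; simp add: algebra_simps)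

lemma fischer_commute: "fischer d f g = fischer d g f"
  unfolding fischer_def by (intro sum.cong) simp_all

text \<open>Each factor crosses over as a Laplacian, which fixes \<open>g\<close>, and lowers the
  degree by 2.\<close>

lemma fischer_norm2_mult_power:
  assumes "\<And>\<alpha>. laplace g \<alpha> = g \<alpha>"
  shows "fischer (d + 2 * j) ((norm2_mult ^^ j) f) g = fischer d f g"
proof (induction j)
  case (Suc j)
  have "laplace g = g" using assms by blast
  then show ?case
    using fischer_norm2_mult[of "d + 2 * j" "(norm2_mult ^^ j) f" g] Suc by simp
qed simp

lemma fischer_norm2_mult_harmonic:
  assumes "\<And>\<alpha>. \<alpha> \<in> multi_indices d \<Longrightarrow> laplace g \<alpha> = 0"
  shows "fischer (d + 2) (norm2_mult f) g = 0"
  unfolding fischer_norm2_mult using assms by (simp add: fischer_def)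

subsection \<open>Gegenbauer polynomials\<close>

text \<open>The usual coefficients have the factors with \<open>i < j\<close> as denominator.
  Multiplying by the full product over \<open>i < k div 2\<close> leaves integers.\<close>

definition harmonic_coeff :: "nat \<Rightarrow> nat \<Rightarrow> nat \<Rightarrow> int" where
  "harmonic_coeff n k j = (- 1) ^ j *
     (\<Prod>i = j..<k div 2. 2 * (int i + 1) * (2 * int k + int n - 2 * int i - 4))"

text \<open>For unit \<open>x\<close> the part of degree \<open>k\<close> is the harmonic projection
  of \<open>(x \<bullet> z) ^ k\<close>, times the constant \<open>harmonic_coeff n k 0 / k!\<close>
  in dimension \<open>n\<close>.\<close>

definition zonal_harmonic :: "nat \<Rightarrow> real ^ 'n::finite \<Rightarrow> ('n \<Rightarrow> nat) \<Rightarrow> real" where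
  "zonal_harmonic k x \<alpha> =
     (\<Sum>j\<le>k div 2. of_int (harmonic_coeff CARD('n) k j) * (norm2_mult ^^ j) (exp_coeffs x) \<alpha>)"

text \<open>This recursion makes \<open>laplace (zonal_harmonic k x)\<close> telescope to \<open>0\<close> in degree \<open>k - 2\<close>.\<close>

lemma harmonic_coeff_Suc:
  assumes "Suc j \<le> k div 2"
  shows "real_of_int (harmonic_coeff n k (Suc j)) *
      (2 * (real j + 1) * (2 * real k + real n - 2 * real j - 4)) = - of_int (harmonic_coeff n k j)"
proof -
  have "{j..<k div 2} = insert j {Suc j..<k div 2}" using assms by auto
  then show ?thesis
    unfolding harmonic_coeff_def by simp
qed

lemma laplace_zonal_harmonic:
  fixes x :: "real ^ 'n::finite"
  assumes x: "norm x = 1" and \<alpha>: "\<alpha> \<in> multi_indices d" and d: "d + 2 = k"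
  shows "laplace (zonal_harmonic k x) \<alpha> = 0"
proof -
  let ?K = "k div 2" and ?c = "\<lambda>j. real_of_int (harmonic_coeff CARD('n) k j)" and ?M = "\<lambda>j. (norm2_mult ^^ j) (exp_coeffs x) \<alpha>"
  have eig: "laplace (exp_coeffs x) \<beta> = exp_coeffs x \<beta>" for \<beta>
    using laplace_exp_coeffs[of x \<beta>] x by simp
  obtain K where K: "?K = Suc K" using d by (metis Suc_1 add_2_eq_Suc' div_add_self2 nat.distinct(1) One_nat_def Suc_eq_plus1)
  have \<alpha>d: "real (\<Sum>i\<in>UNIV. \<alpha> i) = real k - 2" using \<alpha> d by (auto simp: multi_indices_def)
  have step: "?c (Suc j) * laplace ((norm2_mult ^^ Suc j) (exp_coeffs x)) \<alpha> =
      ?c (Suc j) * ?M (Suc j) - ?c j * ?M j" if "j \<le> K" for j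
  proof -
    have "c * (m + a * m') = c * m - c' * m'" if "c * a = - c'" for a c c' m m' :: real
      using that by (simp add: distrib_left mult.assoc[symmetric])
    moreover have "?c (Suc j) * (2 * real (Suc j) * (2 * (real k - 2) - 2 * real j + real CARD('n))) = - ?c j"
      using harmonic_coeff_Suc[of j k "CARD('n)"] that K by (simp add: algebra_simps)
    ultimately show ?thesis
      unfolding laplace_norm2_mult_power[OF eig] \<alpha>d by blast
  qed
  have "laplace (zonal_harmonic k x) \<alpha> = (\<Sum>j\<le>Suc K. ?c j * laplace ((norm2_mult ^^ j) (exp_coeffs x)) \<alpha>)"
    unfolding zonal_harmonic_def K by (rule laplace_sum)
  also have "\<dots> = ?c 0 * ?M 0 + (\<Sum>j\<le>K. ?c (Suc j) * ?M (Suc j) - ?c j * ?M j)"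
    unfolding sum.atMost_Suc_shift using step eig by simp
  also have "\<dots> = ?c (Suc K) * ?M (Suc K)"
    using sum_telescope[of "\<lambda>j. - ?c j * ?M j" K] by (simp add: algebra_simps)
  \<comment> \<open>This term is divisible by the power \<open>2 * Suc K \<ge> k - 1\<close> of the
    norm, so it has no part of degree \<open>k - 2\<close>.\<close>
  also have "?M (Suc K) = 0"
    using \<alpha> d K by (intro norm2_mult_power_eq_0) (auto simp: multi_indices_def)
  finally show ?thesis by simp
qed

text \<open>Multiples of the squared norm are orthogonal to harmonic polynomials, so only
  \<open>j = 0\<close> survives on the left. On the right the powers of the norm cross over to the
  exponential, which the Laplacian fixes.\<close>

lemma fischer_zonal_harmonic:
  fixes x y :: "real ^ 'n::finite"
  assumes x: "norm x = 1" and y: "norm y = 1"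
  shows "fischer k (zonal_harmonic k x) (zonal_harmonic k y) = of_int (harmonic_coeff CARD('n) k 0) *
    (\<Sum>j\<le>k div 2. of_int (harmonic_coeff CARD('n) k j) * ((x \<bullet> y) ^ (k - 2 * j) / fact (k - 2 * j)))"
proof -
  let ?c = "\<lambda>j. real_of_int (harmonic_coeff CARD('n) k j)"
  have *: "fischer k ((norm2_mult ^^ j) (exp_coeffs x)) (zonal_harmonic k y) = 0"
    if j: "j \<in> {1..k div 2}" for j
  proof -
    obtain i where "j = Suc i" using j by (cases j) auto
    moreover obtain d where "k = d + 2"
    proof
      show "k = (k - 2) + 2" using j by auto
    qed
    ultimately show ?thesis
      using fischer_norm2_mult_harmonic[of d "zonal_harmonic k y"] laplace_zonal_harmonic[OF y]
      by simp
  qed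
  have "fischer k (zonal_harmonic k x) (zonal_harmonic k y) =
      (\<Sum>j\<le>k div 2. ?c j * fischer k ((norm2_mult ^^ j) (exp_coeffs x)) (zonal_harmonic k y))"
    unfolding zonal_harmonic_def[of k x, abs_def] by (rule fischer_sum_left)
  also have "\<dots> = ?c 0 * fischer k (exp_coeffs x) (zonal_harmonic k y)"
    using * by (subst sum.remove[of _ 0]) (auto intro!: sum.neutral)
  also have "fischer k (exp_coeffs x) (zonal_harmonic k y) =
      (\<Sum>j\<le>k div 2. ?c j * fischer k ((norm2_mult ^^ j) (exp_coeffs y)) (exp_coeffs x))"
    unfolding fischer_commute[of k "exp_coeffs x"] zonal_harmonic_def[abs_def] by (rule fischer_sum_left)
  also have "\<dots> = (\<Sum>j\<le>k div 2. ?c j * ((x \<bullet> y) ^ (k - 2 * j) / fact (k - 2 * j)))"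
  proof (intro sum.cong refl arg_cong2[where f = "(*)"])
    fix j assume "j \<in> {..k div 2}"
    then have "k = k - 2 * j + 2 * j" by auto
    then show "fischer k ((norm2_mult ^^ j) (exp_coeffs y)) (exp_coeffs x) =
        (x \<bullet> y) ^ (k - 2 * j) / fact (k - 2 * j)"
      using fischer_norm2_mult_power[of "exp_coeffs x" "k - 2 * j" j "exp_coeffs y"]
        laplace_exp_coeffs[of x] x fischer_exp_coeffs[of "k - 2 * j" y x]
      by (simp add: inner_commute)
  qed
  finally show ?thesis .
qed

text \<open>For \<open>i < k div 2\<close> the last factor is at least \<open>k + n - 2\<close>, and
  such an \<open>i\<close> exists only if \<open>k \<ge> 2\<close>.\<close>

lemma harmonic_coeff_0_pos:
  assumes "0 < n" shows "0 < harmonic_coeff n k 0"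
  unfolding harmonic_coeff_def using assms by (auto intro!: prod_pos)

text \<open>The falling factorial is \<open>k! / (k - 2 j)!\<close>; it clears the denominators left
  in \<open>fischer_zonal_harmonic\<close>.\<close>

definition gegenbauer_coeff :: "nat \<Rightarrow> nat \<Rightarrow> nat \<Rightarrow> int" where
  "gegenbauer_coeff n k j = (\<Prod>i<2 * j. int k - int i) * harmonic_coeff n k j"

text \<open>For \<open>n \<ge> 3\<close> a positive multiple of the classical polynomial with
  parameter \<open>n / 2 - 1\<close>, not normalised at \<open>t = 1\<close>.\<close>

definition gegenbauer :: "nat \<Rightarrow> nat \<Rightarrow> real \<Rightarrow> real" where
  "gegenbauer n k t = (\<Sum>j\<le>k div 2. of_int (gegenbauer_coeff n k j) * t ^ (k - 2 * j))"

lemma fact_eq_prod_mult_fact: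
  "m \<le> k \<Longrightarrow> fact k = (\<Prod>i<m. real k - real i) * fact (k - m)"
proof (induction m)
  case (Suc m)
  then have "k - m = Suc (k - Suc m)" by simp
  then have "(fact (k - m) :: real) = (real k - real m) * fact (k - Suc m)"
    using Suc.prems by (simp add: of_nat_diff)
  then show ?case using Suc by simp
qed simp

lemma gegenbauer_coeff_eq:
  assumes "j \<le> k div 2"
  shows "real_of_int (gegenbauer_coeff n k j) = fact k * (of_int (harmonic_coeff n k j) / fact (k - 2 * j))"
  using fact_eq_prod_mult_fact[of "2 * j" k] assms by (simp add: gegenbauer_coeff_def)

text \<open>Up to positive factors the double sum is the Fischer square of the sum of the zonal
  harmonics of all points.\<close>

lemma gegenbauer_positive_definite:
  fixes X :: "(real ^ 'n::finite) set"
  assumes "\<And>x. x \<in> X \<Longrightarrow> norm x = 1"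
  shows "0 \<le> (\<Sum>x\<in>X. \<Sum>y\<in>X. gegenbauer CARD('n) k (x \<bullet> y))"
proof -
  let ?c = "\<lambda>j. real_of_int (harmonic_coeff CARD('n) k j)"
  have g: "?c 0 * gegenbauer CARD('n) k (x \<bullet> y) =
      fact k * fischer k (zonal_harmonic k x) (zonal_harmonic k y)" if "x \<in> X" "y \<in> X" for x y
    using that assms
    by (simp add: fischer_zonal_harmonic gegenbauer_def gegenbauer_coeff_eq sum_distrib_left algebra_simps)
  have "?c 0 * (\<Sum>x\<in>X. \<Sum>y\<in>X. gegenbauer CARD('n) k (x \<bullet> y)) =
      fact k * (\<Sum>x\<in>X. \<Sum>y\<in>X. fischer k (zonal_harmonic k x) (zonal_harmonic k y))"
    unfolding sum_distrib_left using g by (intro sum.cong refl) simp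
  also have "(\<Sum>x\<in>X. \<Sum>y\<in>X. fischer k (zonal_harmonic k x) (zonal_harmonic k y)) =
      fischer k (\<lambda>\<alpha>. \<Sum>x\<in>X. 1 * zonal_harmonic k x \<alpha>) (\<lambda>\<alpha>. \<Sum>x\<in>X. 1 * zonal_harmonic k x \<alpha>)"
    unfolding fischer_sum_left fischer_commute[of k "zonal_harmonic k _" "\<lambda>\<alpha>. \<Sum>x\<in>X. 1 * zonal_harmonic k x \<alpha>"]
    by (simp add: fischer_commute)
  also have "fact k * \<dots> \<ge> 0"
    unfolding fischer_def
    by (rule mult_nonneg_nonneg, simp, rule sum_nonneg, simp only: mult.assoc,
        rule mult_nonneg_nonneg[OF prod_nonneg zero_le_square]) simp
  finally show ?thesis
    using harmonic_coeff_0_pos[of "CARD('n)" k] by (simp add: zero_le_mult_iff)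
qed


subsection \<open>The linear programming bound\<close>

lemma gegenbauer_0: "gegenbauer n 0 t = 1"
  by (simp add: gegenbauer_def gegenbauer_coeff_def harmonic_coeff_def)

lemma gegenbauer_sum_ge:
  fixes X :: "(real ^ 'n::finite) set"
  assumes "\<And>x. x \<in> X \<Longrightarrow> norm x = 1" and c: "\<And>k. 0 \<le> c k"
  shows "c 0 * (real (card X))\<^sup>2 \<le> (\<Sum>x\<in>X. \<Sum>y\<in>X. \<Sum>k<Suc d. c k * gegenbauer CARD('n) k (x \<bullet> y))"
proof -
  have "(\<Sum>x\<in>X. \<Sum>y\<in>X. \<Sum>k<Suc d. c k * gegenbauer CARD('n) k (x \<bullet> y)) =
      (\<Sum>k<Suc d. c k * (\<Sum>x\<in>X. \<Sum>y\<in>X. gegenbauer CARD('n) k (x \<bullet> y)))"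
    unfolding sum_distrib_left sum.swap[of _ "{..<Suc d}"] ..
  also have "\<dots> = c 0 * (real (card X))\<^sup>2 +
      (\<Sum>k<d. c (Suc k) * (\<Sum>x\<in>X. \<Sum>y\<in>X. gegenbauer CARD('n) (Suc k) (x \<bullet> y)))"
    unfolding sum.lessThan_Suc_shift by (simp add: gegenbauer_0 power2_eq_square)
  also have "\<dots> \<ge> c 0 * (real (card X))\<^sup>2"
    using c gegenbauer_positive_definite[OF assms(1)] by (simp add: sum_nonneg)
  finally show ?thesis .
qed

text \<open>
  With weights \<open>s y = - (x \<bullet> y)\<close>, Cauchy-Schwarz for \<open>- x\<close> and \<open>\<Sum>y. s y *\<^sub>R y\<close> gives
  \<open>(\<Sum>s\<^sup>2)\<^sup>2 \<le> (\<Sum>s\<^sup>2 + (\<Sum>s)\<^sup>2) / 2 \<le> (m + 1) / 2 * \<Sum>s\<^sup>2\<close>, where \<open>m = card Y\<close>.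
\<close>

lemma cap_sum_le_1:
  fixes x :: "'a::real_inner"
  assumes fin: "finite Y" and x: "norm x = 1"
    and unit: "\<And>y. y \<in> Y \<Longrightarrow> norm y = 1"
    and sep: "\<And>y z. y \<in> Y \<Longrightarrow> z \<in> Y \<Longrightarrow> y \<noteq> z \<Longrightarrow> y \<bullet> z \<le> 1 / 2"
    and far: "\<And>y. y \<in> Y \<Longrightarrow> x \<bullet> y \<le> 0"
  shows "(\<Sum>y\<in>Y. 2 * (x \<bullet> y)\<^sup>2 - 1) \<le> 1"
proof -
  define s where "s y = - (x \<bullet> y)" for y
  define Q where "Q = (\<Sum>y\<in>Y. (s y)\<^sup>2)"
  define v where "v = (\<Sum>y\<in>Y. s y *\<^sub>R y)"
  have s: "0 \<le> s y" if "y \<in> Y" for y using far[OF that] by (simp add: s_def)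
  have Q0: "0 \<le> Q" unfolding Q_def by (simp add: sum_nonneg)
  have "Q = (- x) \<bullet> v"
    unfolding Q_def v_def inner_sum_right by (intro sum.cong) (simp_all add: s_def power2_eq_square)
  also have "\<dots> \<le> norm v" using norm_cauchy_schwarz[of "- x" v] x by simp
  finally have "Q\<^sup>2 \<le> (norm v)\<^sup>2" using Q0 by (simp add: power_mono)
  also have "(norm v)\<^sup>2 = (\<Sum>y\<in>Y. \<Sum>z\<in>Y. s y * s z * (y \<bullet> z))"
    unfolding power2_norm_eq_inner v_def inner_sum_left inner_sum_right
    by (simp add: algebra_simps inner_commute)
  \<comment> \<open>On the diagonal \<open>y \<bullet> y = 1 = 1 / 2 + 1 / 2\<close>, so half of
    \<open>(s y)\<^sup>2\<close> is added there.\<close>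
  also have "\<dots> \<le> (\<Sum>y\<in>Y. \<Sum>z\<in>Y. s y * s z / 2 + (if y = z then (s y)\<^sup>2 / 2 else 0))"
  proof (intro sum_mono)
    fix y z assume "y \<in> Y" "z \<in> Y"
    then show "s y * s z * (y \<bullet> z) \<le> s y * s z / 2 + (if y = z then (s y)\<^sup>2 / 2 else 0)"
      using unit[of y] sep[of y z] mult_left_mono[of "y \<bullet> z" "1 / 2" "s y * s z"] s[of y] s[of z]
      by (auto simp: power2_eq_square norm_eq_1)
  qed
  also have "\<dots> = (\<Sum>y\<in>Y. s y)\<^sup>2 / 2 + Q / 2"
    using fin
    by (simp add: sum.distrib Q_def sum_divide_distrib[symmetric] power2_eq_square sum_product)
  also have "(\<Sum>y\<in>Y. s y)\<^sup>2 \<le> real (card Y) * Q"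
    using sum_squared_le_sum_of_squares[of s Y] by (simp add: Q_def mult.commute)
  finally have "Q * Q \<le> (real (card Y) + 1) / 2 * Q"
    by (simp add: power2_eq_square algebra_simps add_divide_distrib)
  then have "Q \<le> (real (card Y) + 1) / 2"
    using Q0 by (cases "Q = 0") (simp_all add: mult_le_cancel_right)
  then show ?thesis
    by (simp add: sum_subtractf sum_distrib_left[symmetric] Q_def s_def)
qed

lemma spherical_code_bound:
  fixes X :: "(real ^ 'n::finite) set"
  assumes fin: "finite X"
    and unit: "\<And>x. x \<in> X \<Longrightarrow> norm x = 1"
    and sep: "pairwise (\<lambda>x y. x \<bullet> y \<le> 1 / 2) X"
    and f: "\<And>t. f t = (\<Sum>k<Suc d. c k * gegenbauer CARD('n) k t)"
    and c: "\<And>k. 0 \<le> c k" and B: "0 \<le> B" and \<rho>: "0 \<le> \<rho>"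
    and near: "\<And>t. - \<rho> \<le> t \<Longrightarrow> t \<le> 1 / 2 \<Longrightarrow> f t \<le> 0"
    and far: "\<And>t. - 1 \<le> t \<Longrightarrow> t \<le> - \<rho> \<Longrightarrow> f t \<le> B * (2 * t\<^sup>2 - 1)"
  shows "c 0 * real (card X) \<le> f 1 + B"
proof (cases "X = {}")
  case True
  \<comment> \<open>Dividing by \<open>card X\<close> is impossible here; positive definiteness on a
    single point gives \<open>f 1 \<ge> 0\<close> instead.\<close>
  have "0 \<le> gegenbauer CARD('n) k 1" for k
    using gegenbauer_positive_definite[of "{axis undefined 1 :: real ^ 'n}" k]
    by (simp add: norm_eq_1[symmetric])
  then show ?thesis unfolding f using True c B by (simp add: sum_nonneg)
next
  case False
  have row: "(\<Sum>y\<in>X. f (x \<bullet> y)) \<le> f 1 + B" if x: "x \<in> X" for x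
  proof -
    define Y where "Y = {y \<in> X - {x}. x \<bullet> y < - \<rho>}"
    have sep': "y \<bullet> z \<le> 1 / 2" if "y \<in> X" "z \<in> X" "y \<noteq> z" for y z
      using sep that by (auto simp: pairwise_def)
    have "(\<Sum>y\<in>X. f (x \<bullet> y)) = f 1 + (\<Sum>y\<in>X - {x}. f (x \<bullet> y))"
      using unit[OF x] by (subst sum.remove[OF fin x]) (simp add: norm_eq_1)
    also have "(\<Sum>y\<in>X - {x}. f (x \<bullet> y)) \<le> (\<Sum>y\<in>X - {x}. if x \<bullet> y < - \<rho> then B * (2 * (x \<bullet> y)\<^sup>2 - 1) else 0)"
    proof (rule sum_mono)
      fix y assume y: "y \<in> X - {x}"
      have "- 1 \<le> x \<bullet> y"
        using Cauchy_Schwarz_ineq2[of x y] unit[OF x] unit[of y] y by auto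
      then show "f (x \<bullet> y) \<le> (if x \<bullet> y < - \<rho> then B * (2 * (x \<bullet> y)\<^sup>2 - 1) else 0)"
        using near[of "x \<bullet> y"] far[of "x \<bullet> y"] sep'[of x y] x y by auto
    qed
    also have "\<dots> = B * (\<Sum>y\<in>Y. 2 * (x \<bullet> y)\<^sup>2 - 1)"
      using fin by (simp add: Y_def sum.If_cases Int_def sum_distrib_left)
    also have "\<dots> \<le> B * 1"
      using fin unit x sep' B \<rho> by (intro mult_left_mono cap_sum_le_1) (auto simp: Y_def)
    finally show ?thesis by simp
  qed
  have "c 0 * (real (card X))\<^sup>2 \<le> (\<Sum>x\<in>X. \<Sum>y\<in>X. f (x \<bullet> y))"
    unfolding f by (intro gegenbauer_sum_ge unit c)
  also have "\<dots> \<le> real (card X) * (f 1 + B)"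
    using sum_mono[of X "\<lambda>x. \<Sum>y\<in>X. f (x \<bullet> y)" "\<lambda>_. f 1 + B"] row by simp
  finally have "real (card X) * (c 0 * real (card X)) \<le> real (card X) * (f 1 + B)"
    by (simp add: power2_eq_square algebra_simps)
  then show ?thesis using False fin by (simp add: mult_le_cancel_left card_gt_0_iff)
qed

subsection \<open>Certificates in integer arithmetic\<close>

text \<open>
  Univariate polynomials are coefficient lists, constant term first. A polynomial \<open>p\<close> is certified
  to be nonnegative on an interval inside \<open>[-1, 1]\<close> by a product of squares \<open>(den * t - num)\<^sup>2\<close> and a
  nonnegative combination of Bernstein products, up to a small remainder whose constant
  term dominates its other coefficients; the remainder absorbs the rounding of all data.
  Interval ends and double roots are fractions \<open>(num, den)\<close> with \<open>den > 0\<close>.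
\<close>

primrec eval_poly :: "int list \<Rightarrow> real \<Rightarrow> real" where
  "eval_poly [] t = 0"
| "eval_poly (a # p) t = of_int a + t * eval_poly p t"

fun add_poly :: "int list \<Rightarrow> int list \<Rightarrow> int list" where
  "add_poly [] q = q"
| "add_poly p [] = p"
| "add_poly (a # p) (b # q) = (a + b) # add_poly p q"

definition smult_poly :: "int \<Rightarrow> int list \<Rightarrow> int list" where
  "smult_poly c p = map ((*) c) p"

definition mult_linear :: "int \<Rightarrow> int \<Rightarrow> int list \<Rightarrow> int list" where
  "mult_linear a b p = add_poly (smult_poly a p) (0 # smult_poly b p)"

text \<open>The second component is \<open>(b\<^sub>0 + b\<^sub>1 t) ^ length cs\<close>, carried along to avoid recomputing powers.\<close>

primrec bernstein_poly :: "int \<Rightarrow> int \<Rightarrow> int \<Rightarrow> int \<Rightarrow> int list \<Rightarrow> int list \<times> int list" where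
  "bernstein_poly a0 a1 b0 b1 [] = ([], [1])"
| "bernstein_poly a0 a1 b0 b1 (c # cs) =
     (case bernstein_poly a0 a1 b0 b1 cs of (p, q) \<Rightarrow>
       (add_poly (smult_poly c q) (mult_linear a0 a1 p), mult_linear b0 b1 q))"

primrec mult_squares :: "(int \<times> int) list \<Rightarrow> int list \<Rightarrow> int list" where
  "mult_squares [] p = p"
| "mult_squares (r # rs) p =
     mult_linear (- fst r) (snd r) (mult_linear (- fst r) (snd r) (mult_squares rs p))"

fun dominated :: "int list \<Rightarrow> bool" where
  "dominated [] \<longleftrightarrow> True"
| "dominated (a # p) \<longleftrightarrow> sum_list (map abs p) \<le> a"

text \<open>Lists start with the constant term, so \<open>j\<close> descends. For odd
  \<open>k\<close> and \<open>m = k div 2\<close> this is the polynomial divided by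
  \<open>t\<close>.\<close>

primrec gegenbauer_even_poly :: "nat \<Rightarrow> nat \<Rightarrow> nat \<Rightarrow> int list" where
  "gegenbauer_even_poly n k 0 = [gegenbauer_coeff n k 0]"
| "gegenbauer_even_poly n k (Suc m) =
     gegenbauer_coeff n k (Suc m) # 0 # gegenbauer_even_poly n k m"

definition gegenbauer_poly :: "nat \<Rightarrow> nat \<Rightarrow> int list" where
  "gegenbauer_poly n k =
     (if even k then gegenbauer_even_poly n k (k div 2) else 0 # gegenbauer_even_poly n k (k div 2))"

primrec gegenbauer_series :: "nat \<Rightarrow> nat \<Rightarrow> int list \<Rightarrow> int list" where
  "gegenbauer_series n k [] = []"
| "gegenbauer_series n k (c # cs) =
     add_poly (smult_poly c (gegenbauer_poly n k)) (gegenbauer_series n (Suc k) cs)"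

definition certified_nonneg ::
  "int \<times> int \<Rightarrow> int \<times> int \<Rightarrow> (int \<times> int) list \<Rightarrow> int list \<Rightarrow> int list \<Rightarrow> bool" where
  "certified_nonneg a b rs cs p \<longleftrightarrow> list_all ((\<le>) 0) cs \<and>
     dominated (add_poly p (smult_poly (- 1) (mult_squares rs
       (fst (bernstein_poly (- fst a) (snd a) (fst b) (- snd b) cs)))))"

section \<open>Soundness of the integer computations\<close>

lemma eval_add_poly [simp]: "eval_poly (add_poly p q) t = eval_poly p t + eval_poly q t"
  by (induction p q rule: add_poly.induct) (auto simp: algebra_simps)

lemma eval_smult_poly [simp]: "eval_poly (smult_poly c p) t = of_int c * eval_poly p t"
  by (induction p) (auto simp: smult_poly_def algebra_simps)

lemma eval_mult_linear [simp]: "eval_poly (mult_linear a b p) t = (of_int a + of_int b * t) * eval_poly p t"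
  by (simp add: mult_linear_def algebra_simps)

lemma eval_mult_squares_nonneg: "0 \<le> eval_poly p t \<Longrightarrow> 0 \<le> eval_poly (mult_squares rs p) t"
proof (induction rs)
  case (Cons r rs)
  then have "0 \<le> (of_int (- fst r) + of_int (snd r) * t)\<^sup>2 * eval_poly (mult_squares rs p) t"
    by (intro mult_nonneg_nonneg) auto
  then show ?case by (simp add: power2_eq_square mult.assoc)
qed simp

lemma eval_bernstein_nonneg:
  assumes "list_all ((\<le>) 0) cs"
    and "0 \<le> of_int a0 + of_int a1 * t" "0 \<le> of_int b0 + of_int b1 * t"
  shows "0 \<le> eval_poly (fst (bernstein_poly a0 a1 b0 b1 cs)) t \<and>
    0 \<le> eval_poly (snd (bernstein_poly a0 a1 b0 b1 cs)) t"
  using assms(1) by (induction cs) (auto simp: assms split: prod.split)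

lemma eval_dominated_nonneg:
  assumes "dominated p" "\<bar>t\<bar> \<le> 1"
  shows "0 \<le> eval_poly p t"
proof (cases p)
  case (Cons a q)
  have "\<bar>eval_poly q t\<bar> \<le> of_int (sum_list (map abs q))"
  proof (induction q)
    case (Cons b q)
    have "\<bar>t * eval_poly q t\<bar> \<le> 1 * \<bar>eval_poly q t\<bar>"
      unfolding abs_mult using assms(2) by (intro mult_right_mono) auto
    then show ?case using Cons by simp
  qed simp
  moreover have "\<bar>t * eval_poly q t\<bar> \<le> 1 * \<bar>eval_poly q t\<bar>"
    unfolding abs_mult using assms(2) by (intro mult_right_mono) auto
  moreover have "of_int (sum_list (map abs q)) \<le> (of_int a :: real)"
    using assms(1) Cons by simp
  ultimately show ?thesis using Cons by simp
qed simp

lemma certified_nonneg: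
  assumes "certified_nonneg a b rs cs p" and "\<bar>t\<bar> \<le> 1"
    and "of_int (fst a) \<le> of_int (snd a) * t" and "of_int (snd b) * t \<le> of_int (fst b)"
  shows "0 \<le> eval_poly p t"
proof -
  let ?q = "mult_squares rs (fst (bernstein_poly (- fst a) (snd a) (fst b) (- snd b) cs))"
  have "0 \<le> eval_poly (add_poly p (smult_poly (- 1) ?q)) t"
    using assms by (intro eval_dominated_nonneg) (auto simp: certified_nonneg_def)
  moreover have "0 \<le> eval_poly ?q t"
    using assms
    by (intro eval_mult_squares_nonneg eval_bernstein_nonneg[THEN conjunct1]) (auto simp: certified_nonneg_def)
  ultimately show ?thesis by simp
qed

lemma eval_gegenbauer_even_poly:
  "eval_poly (gegenbauer_even_poly n k m) t =
    (\<Sum>j\<le>m. of_int (gegenbauer_coeff n k j) * t ^ (2 * (m - j)))"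
proof (induction m)
  case (Suc m)
  have "t * (t * eval_poly (gegenbauer_even_poly n k m) t) =
      (\<Sum>j\<le>m. of_int (gegenbauer_coeff n k j) * t ^ (2 * (Suc m - j)))"
    unfolding Suc.IH sum_distrib_left
    by (intro sum.cong) (auto simp: Suc_diff_le)
  then show ?case by simp
qed simp

lemma eval_gegenbauer_poly: "eval_poly (gegenbauer_poly n k) t = gegenbauer n k t"
proof (cases "even k")
  case True
  then show ?thesis
    by (auto simp: gegenbauer_poly_def gegenbauer_def eval_gegenbauer_even_poly right_diff_distrib'
        elim!: evenE)
next
  case False
  have "t * t ^ (2 * (k div 2 - j)) = t ^ (k - 2 * j)" if "j \<le> k div 2" for j
  proof -
    have "k - 2 * j = Suc (2 * (k div 2 - j))" using False that by (auto elim!: oddE)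
    then show ?thesis by simp
  qed
  then show ?thesis
    using False
    by (auto simp: gegenbauer_poly_def gegenbauer_def eval_gegenbauer_even_poly sum_distrib_left
        mult.left_commute intro!: sum.cong)
qed

lemma eval_gegenbauer_series:
  "eval_poly (gegenbauer_series n k cs) t = (\<Sum>i<length cs. of_int (cs ! i) * gegenbauer n (k + i) t)"
  by (induction cs arbitrary: k)
    (simp_all add: eval_gegenbauer_poly sum.lessThan_Suc_shift del: sum.lessThan_Suc)

text \<open>
  Here \<open>f\<close> lists Gegenbauer coefficients, \<open>p\<close> is the polynomial they define, and \<open>99/140\<close>
  is a rational just above \<open>1/\<surd>2\<close>.
\<close>

definition kissing_certificate ::
  "nat \<Rightarrow> int \<Rightarrow> int list \<Rightarrow> int \<Rightarrow> int list \<Rightarrow> (int \<times> int) list \<Rightarrow> int list \<Rightarrow> int \<times> int \<Rightarrow> int list \<Rightarrow> bool" where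
  "kissing_certificate n N f B p rs cs r ds \<longleftrightarrow>
     p = gegenbauer_series n 0 f \<and> f \<noteq> [] \<and> list_all ((\<le>) 0) f \<and> 0 \<le> B \<and>
     sum_list p + B < (N + 1) * hd f \<and>
     certified_nonneg (- 99, 140) (1, 2) rs cs (smult_poly (- 1) p) \<and>
     certified_nonneg (- 1, 1) (- 99, 140) [r] ds (add_poly [- B, 0, 2 * B] (smult_poly (- 1) p))"

lemma eval_poly_1: "eval_poly p 1 = of_int (sum_list p)"
  by (induction p) simp_all

text \<open>Halving the centres gives unit vectors, to which \<open>spherical_code_bound\<close>
  applies with \<open>\<rho> = 99 / 140\<close>. The equations for \<open>n\<close> and
  \<open>M\<close> are separate so that the certificates contain only numerals.\<close>

lemma kissing_number_le:
  assumes "kissing_certificate n M f B p rs cs r ds" and "CARD('n) = n" and "M = int N"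
  shows "kissing_number TYPE(real ^ 'n::finite) \<le> N"
proof -
  note cert = assms(1)[folded assms(2), unfolded assms(3) kissing_certificate_def]
  obtain C :: "(real ^ 'n) set" where C: "finite C" "kissing_arrangement C"
    "card C = kissing_number TYPE(real ^ 'n)"
    using kissing_number_is_max(1) by blast
  define X where "X = (\<lambda>x. (1 / 2) *\<^sub>R x) ` C"
  have CX: "C = (\<lambda>x. 2 *\<^sub>R x) ` X" by (auto simp: X_def image_image)
  have X: "\<And>x. x \<in> X \<Longrightarrow> norm x = 1" "pairwise (\<lambda>x y. x \<bullet> y \<le> 1 / 2) X" "finite X"
    using C kissing_arrangement_unit_vectors_iff[of X] unfolding CX[symmetric] by (auto simp: X_def)
  have card: "card X = kissing_number TYPE(real ^ 'n)"
    unfolding C(3)[symmetric] CX by (subst card_image) (auto simp: inj_on_def)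
  define c where "c k = (if k < length f then real_of_int (f ! k) else 0)" for k
  obtain d where d: "length f = Suc d" using cert by (cases f) auto
  have p: "eval_poly p t = (\<Sum>k<Suc d. c k * gegenbauer CARD('n) k t)" for t
    using cert d by (auto simp: eval_gegenbauer_series c_def intro!: sum.cong)
  have "c 0 * real (card X) \<le> eval_poly p 1 + of_int B"
  proof (rule spherical_code_bound[OF X(3,1,2) p, where \<rho> = "99 / 140"])
    show "0 \<le> c k" for k using cert by (auto simp: c_def list_all_length)
    show "eval_poly p t \<le> 0" if "- (99 / 140) \<le> t" "t \<le> 1 / 2" for t
      using certified_nonneg[of "(- 99, 140)" "(1, 2)" rs cs "smult_poly (- 1) p" t] cert that
      by (auto simp: abs_le_iff)
    show "eval_poly p t \<le> of_int B * (2 * t\<^sup>2 - 1)" if "- 1 \<le> t" "t \<le> - (99 / 140)" for t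
      using certified_nonneg[of "(- 1, 1)" "(- 99, 140)" "[r]" ds
          "add_poly [- B, 0, 2 * B] (smult_poly (- 1) p)" t] cert that
      by (auto simp: abs_le_iff power2_eq_square algebra_simps)
  qed (use cert in auto)
  also have "eval_poly p 1 + of_int B = of_int (sum_list p + B)" by (simp add: eval_poly_1)
  \<comment> \<open>A value strictly below \<open>N + 1\<close> suffices, because the cardinality is
    an integer.\<close>
  also have "\<dots> < of_int ((int N + 1) * hd f)" using cert by (subst of_int_less_iff) blast
  also have "\<dots> = c 0 * (real N + 1)" using cert d by (simp add: c_def hd_conv_nth)
  finally have "c 0 * real (card X) < c 0 * (real N + 1)" .
  moreover have "0 \<le> c 0" using cert d by (auto simp: c_def list_all_length)
  ultimately have "real (card X) < real N + 1" by (simp add: mult_less_cancel_left)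
  then show ?thesis unfolding card by linarith
qed
subsection \<open>The six dimensions\<close>

text \<open>
  The data are optima of the linear program for \<open>f\<close> and \<open>B\<close> with \<open>c\<^sub>0 = 1\<close>, recomputed from
  double roots rounded to small fractions, scaled to integers; the constant Gegenbauer coefficient
  is then lowered slightly to pay for the rounding.
\<close>

lemma certificate_9: "kissing_certificate 9
    379
    [9996175743865452783553077769, 73272286253045638309096981282, 16314325602547743300884434479,
      35962968444583725193890311709, 1382785617679322768279440340, 1440120792556429857333704772,
      14279144426908645387622812, 4745682241290385881355421, 0, 0, 95191346769430773500,
      102393843725952943689]
    30903776550853052157512430159
    [-72034983457422449474447669, 2303497614971206721123286628, -6132989252890896526648117938,
      -218337645963688173413902229682, -794798484271768753021251055840,
      -60446125523121720566607972720, 3834133545317252441623431445440,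
      4675898886038355676919812432560, -2566202138176687293823747200000,
      -4961448644449810467155271840000, 1425667854542604052124304000000,
      2435620243638997865694406176000]
    [(-1, 2), (-11, 35), (2, 43)]
    [0, 76756241389789791024, 6024252097335084324, 58602709800904150, 181413843043666, 0]
    (-15, 16)
    [36331908470726, 31034398607597845, 11651190665865823142, 2513085761076689907381,
      340899950228791103326459, 29803788533326356689834783, 1641194238756617727729125243,
      52080055160979247897290956226, 729791902145008263448904665765,
      14650071963739029453356586503]"
  by code_simp

text \<open>As in all six certificates, each square and Bernstein product matches the degree of
  \<open>f\<close>. The zeros at both ends of \<open>cs\<close> make the product vanish at
  \<open>-99/140\<close> and \<open>1/2\<close>, and \<open>r\<close> is where \<open>f\<close>
  nearly touches \<open>B (2 t\<^sup>2 - 1)\<close>.\<close>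

lemma certificate_10: "kissing_certificate 10
    594
    [999657500405629738893859635716, 8018437320276739271873902182584,
      1714705568486723166310318126929, 4151114229486864172279691429538,
      159315280250791204350037513582, 186707861971372001599782808613,
      1956060972433657365133167064, 899844518876092586162808769, 0, 0, 0,
      20535914865986057415089]
    3632501321866150283040246477386
    [-14550810701060992221756578254, 161750998262095539282509847956,
      1679793751672528342211726730708, -9598335013997386954654432365488,
      -101353776977036881202226765827712, -167101523135066950543740458433280,
      378568216360920311818412620898304, 1073201179138726290601070104197120, 0,
      -1190817573919803862324899729408000, 0, 606234401268263784456312589516800]
    [(-39, 94), (-16, 75), (17, 209)]
    [0, 45469272320178739, 5396491394810609, 54221294785821, 169264366608, 0]
    (-121, 150)
    [133776160759966, 114407259472670370, 42894895442407322095, 9213731017256590663866,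
      1240784721225726862843533, 107335061210480415300389071, 5828376655179448721986685365,
      181772130300095293298594736093, 2496503130245150031701568651062,
      108663247434525230230656003374]"
  by code_simp

lemma certificate_16: "kissing_certificate 16
    8312
    [99997405684762251318370552076435352, 1251952888009722733536804207601465700,
      244621437153662800433991467850982640, 897880799747369664675906122325057386,
      34047991389561654976793615341965076, 64442394470587833975728569395063551,
      800463224892887963686826327704248, 820869109025563036211251258916684,
      3432338687081625080575050022775, 1214018037793031294076053214813, 0, 0,
      6823082191483392933154199, 5526920402347116715183379]
    2825307575105336433133160225310728290
    [-6767034046179789123885000079420264, -64465769633097819336117776442715216,
      302096211035440851523880702423718016, 4209162843880324332545690557911520936,
      2509800510750593369707843332360756480, -71179864326687734601151960831732814272,
      -196058196329351107210063544935699292160, 71470251541332596099338728439908575232,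
      832928858275091246575965758807473766400, 743619484843891691254933017845919006720,
      -493081306692337255108957194421429862400, -653583327817859479693201564099097395200,
      268953440014002139150340287866234470400, 318412390475367438824893069689303859200]
    [(-103, 193), (-30, 71), (-38, 255), (3, 17)]
    [0, 29585806056365464266, 2236378320193395537, 23026043679987815, 76241756049291, 0]
    (-265, 271)
    [8127047974818408, 8628164534387119926, 4151344048910729783355, 1193066653217543673704615,
      226989596070875064072032803, 29894061753005760772677246217,
      2761412755555550770885751500421, 176730777676259403767241871253017,
      7501330508165990191510699625147593, 190687059465458586835876335769732953,
      2205003449851296054245831968142624197, 39414519789045952349525687590280246]"
  by code_simp

lemma certificate_17: "kissing_certificate 17
    12210
    [9999701211784305182846993441444719, 134193826732877670426855878404893342,
      26053566172426946267685693181878565, 100940509127086458072405566586305358,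
      3810159648203482202416810517586711, 7596377328749721044108497360997611,
      94610515224242127036035860339063, 102564395063819545352596686463171,
      435963992613574708179766623210, 164843816925134796768555307129, 0, 0,
      1040892673924861518294689, 1036579106255419713519648]
    293844808762520403750582633224209960
    [-706513099222726779616984394027107, -10535175760034237571454898411957406,
      4534889001462235920678679319197258, 594760920782406545418319283910668244,
      1427032170362198558609853624922408632, -8140054933244179414792617726490950696,
      -34073290339147617371933389703671366800, -4651691647686573642086343470206417200,
      132425742576898092308655147408668332800, 144797894416979815160729869734719779200,
      -88749884788927553147296267016032204800, -143137333960551290700570792627678412800,
      49753723290762416158332755751411993600, 71568666980275645350285396313839206400]
    [(-160, 299), (-105, 278), (-31, 270), (43, 225)]
    [0, 682256523538711, 59829649092160, 591298357108, 1879128380, 0]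
    (-21, 23)
    [240038138308121522, 251060160386392931027, 118753284001179041063081,
      33481598227193735655149309, 6236739716784659373741365734, 802697512987494265028614761486,
      72350127691927729609992865369795, 4512777354461496218650031289058961,
      186535430533925848849973443960194299, 4616409335747198294827371357567427583,
      51979798649686290360689485230977307879, 983800253230941877607070526084413509]"
  by code_simp

lemma certificate_25: "kissing_certificate 25
    278083
    [999999888903930645069132590259320147434148, 19003978859659654731914516005079515107365758,
      3459147526583996315953172053342007282403193, 18990344929114072769095324511873714766424415,
      709828935084776885796522217055978461682053, 2075828951744387452313628651931853239183093,
      28048988599248622445720199473896581752515, 49716782751514815742505226624913088345888,
      287052679726851279120129347654017317046, 294526707239162718122327649179253045287,
      669517453368803763908879950579279308, 226290581415117781487775574669743305, 0, 0,
      811571173047754872145889748057, 821120131270619488252898954627]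
    1480719718371814210658432296012352455924018647
    [-4004789939979178738303340878068508587846, 360096320672050368621089186628062563501468,
      -5964295715151093808789839659303681635785118,
      -100694823641618872846397024676622502807788870,
      -97258221483715717341028294344694394265610488,
      2837750446844552272821271588963910557591214584,
      8418751890974022013926574126214367687197634480,
      -20494688744667689933370008120767240494028623360,
      -106789518696922777619982883509069193859833608960,
      -33514680385406823623608000728037554700372183680,
      355673372053146981088863802463156504111060966400,
      392820554860913004935414034549827016995180832000,
      -256352481655029513891643139293905283262221670400,
      -396332672725702456300151163237063242237854464000,
      138035951660400507480115536542872075602734745600,
      192504441038198335917216279286573574801243596800]
    [(-62, 121), (-55, 149), (-29, 140), (1, 50), (31, 120)]
    [0, 235016816903181754707474, 18359259631131624868184, 175908415171147704187,
      543807819967972865, 0]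
    (-82, 85)
    [38222856787158149240291, 49146039232695217315854161, 29161822034070881690166599150,
      10566069630782637313066918654230, 2605112596335723966422057302144845,
      460688484034190960547346561237161744, 59940715400607879170167547669991721568,
      5783297105781789158747277155536982313723, 410732409281981610436055166337759800944549,
      20941038788818180149139946644157188119288935,
      727488855350195416145344411537450157858814331,
      15459628795430069432593509419589854358430905554,
      152002295185018520962014731987918624509836694343,
      2704682083953371592931694097745301519486297019]"
  by code_simp

lemma certificate_26: "kissing_certificate 26
    396447
    [9999991154052885448080195300615513098813, 201260386248542849328660987513213111699923,
      36668890960715246110538895235257039800427, 209137421224760166911783550609068771225660,
      7804822268045979113793136640057749977805, 23666418644729364621580089810205737412451,
      319992493709258070814244976781850221819, 589337191873530164714055399261875815402,
      3421694799895601176666802801108830973, 3680306715501023728418568458537091475,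
      8496872487500299373859456766925550, 3223990245341127567662439198221872, 0, 0,
      10039675466275930370437135861, 11740108575829675739635782198]
    7040019124275758788343245910718126771572252
    [-162610107142864790259299367940318476241, 7612737258542890665920164014036497548403,
      -32114244497132617876396333893481019919396, -1428155219838902977326603236091725332570880,
      -3636547940159987484350044610717451119451840,
      35820189883192969405219502378778313150966272,
      146805128445884966761194773906075369432266752,
      -209433849108835198933765097125464990797955072,
      -1595540329150110404099803860017139143661453312,
      -869013354501874669549243045799994679240704000,
      5062709213571366064607722444518969723214233600,
      6313972766056278186588776553430675118673100800,
      -3655495021072785330941113906154606854511001600,
      -6489824463441556766337123248676242876006400000,
      2008513747842189742275337311073959810170880000,
      3214008305704390017614575323153948852879360000]
    [(-40, 77), (-35, 93), (-3, 16), (1, 29), (22, 83)]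
    [0, 8720066345046502359985712, 829774013964239150941164, 7935918661154261923522,
      24451903621501594152, 0]
    (-25, 28)
    [4543055950317331807002, 5689848372065821219286664, 3281829748007575402143523903,
      1153566190422143797780609113777, 275416411615374001903811763549224,
      47088316964476428872442703979866296, 5915787415202182904967436932929246312,
      550624804569871096111313217568810867346, 37706594144835759237026542756999722427673,
      1853609001505736241782513086713044731968436, 62113635521933250804655177596495465837867792,
      1274283477675126182083333812792269275870814527,
      12110713202737414031057007441741323581374138401,
      227937301476857073562817335391414649217220039]"
  by code_simp

theorem mainTheorem4:
  shows "kissing_number TYPE(real ^ 9) \<le> 379 \<and>
         kissing_number TYPE(real ^ 10) \<le> 594 \<and>
         kissing_number TYPE(real ^ 16) \<le> 8312 \<and>
         kissing_number TYPE(real ^ 17) \<le> 12210 \<and>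
         kissing_number TYPE(real ^ 25) \<le> 278083 \<and>
         kissing_number TYPE(real ^ 26) \<le> 396447"
proof (intro conjI)
  show "kissing_number TYPE(real ^ 9) \<le> 379"
    by (rule kissing_number_le[OF certificate_9]) simp_all
  show "kissing_number TYPE(real ^ 10) \<le> 594"
    by (rule kissing_number_le[OF certificate_10]) simp_all
  show "kissing_number TYPE(real ^ 16) \<le> 8312"
    by (rule kissing_number_le[OF certificate_16]) simp_all
  show "kissing_number TYPE(real ^ 17) \<le> 12210"
    by (rule kissing_number_le[OF certificate_17]) simp_all
  show "kissing_number TYPE(real ^ 25) \<le> 278083"
    by (rule kissing_number_le[OF certificate_25]) simp_all
  show "kissing_number TYPE(real ^ 26) \<le> 396447"
    by (rule kissing_number_le[OF certificate_26]) simp_all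
qed

end
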